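(* Let $\mathbf{W}\in\mathbb{R}^{b\times c}$, $\mathbf{C}\in\mathbb{R}^{a\times b}$, $\alpha\ge 0$, and let $j,k$ be indices with $1\le j\le\min(a,b)$ and $1\le k\le\min(c,d)$ such that $\mathbf{W}_{j:}\neq 0$ and $\mathbf{W}_{:k}\neq 0$. Let $p\in\{1,\dots,b\}$ and let $\mathbf{A}\in\mathbb{R}^{a\times b}$ be the matrix with $\mathbf{A}_{j,p}=\|\mathbf{C}_{:j}\|_2^{\alpha}\,\|\mathbf{W}_{j:}\|_1^{-1}$ and $\mathbf{A}_{uv}=0$ for all $(u,v)\neq(j,p)$. Let $s\in\{1,\dots,c\}$ and let $\mathbf{B}\in\mathbb{R}^{c\times d}$ be the matrix with $\mathbf{B}_{s,k}=\|\mathbf{C}_{:j}\|_2^{\alpha}\,\|\mathbf{W}_{:k}\|_1^{-1}$ and $\mathbf{B}_{uv}=0$ for all $(u,v)\neq(s,k)$. Then $$\|\mathbf{A}_{j:}\|_2+\|\mathbf{B}_{:k}\|_2=\left(\|\mathbf{W}_{j:}\|_1^{-1}+\|\mathbf{W}_{:k}\|_1^{-1}\right)\|\mathbf{C}_{:j}\|_2^{\alpha}.$$ In particular, if $\mathbf{C}_{:j}=\mathbf{X}_{:j}$ for a matrix $\mathbf{X}\in\mathbb{R}^{a\times b}$, then $$|\mathbf{W}_{jk}|\left(\|\mathbf{A}_{j:}\|_2+\|\mathbf{B}_{:k}\|_2\right)=\mathrm{RIA}_{jk}.$$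
   Context: $\mathbf{M}_{j:}$ and $\mathbf{M}_{:k}$ denote the $j$-th row and $k$-th column of a matrix $\mathbf{M}$; $\|\cdot\|_1,\|\cdot\|_2$ are the $\ell_1$- and $\ell_2$-norms of a vector; $0^0:=1$. For $\mathbf{X}\in\mathbb{R}^{a\times b}$ (input activations) and $\mathbf{W}\in\mathbb{R}^{b\times c}$ (weights), the relative importance with activation is $$\mathrm{RIA}_{jk}:=\left(|\mathbf{W}_{jk}|\,\|\mathbf{W}_{j:}\|_1^{-1}+|\mathbf{W}_{jk}|\,\|\mathbf{W}_{:k}\|_1^{-1}\right)\|\mathbf{X}_{:j}\|_2^{\alpha}.$$ *)

theory Defs
  imports "HOL-Analysis.L2_Norm" "Jordan_Normal_Form.Matrix"
begin

text \<open>
  Dimensions are natural numbers carried by \<^const>\<open>carrier_mat\<close>, since an index may have to be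
  valid for two different dimensions at once. Indices are 0-based: the 1-based range
  from 1 to n becomes \<open>i < n\<close>.
\<close>

definition l1_norm :: "real vec \<Rightarrow> real" where
  "l1_norm v = (\<Sum>i<dim_vec v. \<bar>v $ i\<bar>)"

definition l2_norm :: "real vec \<Rightarrow> real" where
  "l2_norm v = L2_set (\<lambda>i. v $ i) {..<dim_vec v}"

text \<open>
  Real power of a nonnegative base with the convention \<open>0\<^sup>0 = 1\<close>; the library has
  \<open>0 powr 0 = 0\<close>. Everywhere else it is \<^const>\<open>powr\<close>.
\<close>

definition rpow :: "real \<Rightarrow> real \<Rightarrow> real" (infixr \<open>rpow\<close> 80) where
  "x rpow \<alpha> = (if x = 0 \<and> \<alpha> = 0 then 1 else x powr \<alpha>)"

definition RIA :: "real \<Rightarrow> real mat \<Rightarrow> real mat \<Rightarrow> nat \<Rightarrow> nat \<Rightarrow> real" where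
  "RIA \<alpha> X W j k =
     (\<bar>W $$ (j, k)\<bar> * inverse (l1_norm (row W j)) + \<bar>W $$ (j, k)\<bar> * inverse (l1_norm (col W k)))
       * (l2_norm (col X j) rpow \<alpha>)"

end

theory Submission
  imports Defs
begin

text \<open>Row \<open>j\<close> of \<open>A\<close> and column \<open>k\<close> of \<open>B\<close>
  each have at most one nonzero entry, at \<open>p\<close> and \<open>s\<close> respectively. The
  Euclidean norm of such a vector is the absolute value of that entry
  (\<open>l2_norm_single_entry\<close>). Both entries are products of nonnegative factors, so the
  absolute values disappear, and adding the two norms and factoring out the power of the column norm
  gives the identity.\<close>

text \<open>Only one square survives in the sum, and the root of a square is an absolute value; the
  entry may itself be zero.\<close>

lemma l2_norm_single_entry:
  assumes "i < dim_vec v" "\<And>l. l < dim_vec v \<Longrightarrow> l \<noteq> i \<Longrightarrow> v $ l = 0"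
  shows "l2_norm v = \<bar>v $ i\<bar>"
proof -
  have "(\<Sum>l<dim_vec v. (v $ l)\<^sup>2) = (\<Sum>l<dim_vec v. if l = i then (v $ i)\<^sup>2 else 0)"
    using assms(2) by (intro sum.cong) auto
  also have "\<dots> = (v $ i)\<^sup>2"
    using assms(1) by simp
  finally show ?thesis
    by (simp add: l2_norm_def L2_set_def)
qed

lemma l1_norm_nonneg: "0 \<le> l1_norm v"
  by (simp add: l1_norm_def sum_nonneg)

text \<open>No sign condition on \<open>x\<close> is required: \<open>powr\<close> is either 0 or a
  value of \<open>exp\<close>.\<close>

lemma rpow_nonneg: "0 \<le> x rpow \<alpha>"
  by (simp add: rpow_def)

theorem lemma3p6:
  fixes W C A B :: "real mat"
    and a b c d j k p s :: nat
    and \<alpha> :: real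
  assumes W: "W \<in> carrier_mat b c"
    and C: "C \<in> carrier_mat a b"
    and \<alpha>: "\<alpha> \<ge> 0"
    and j: "j < min a b"
    and k: "k < min c d"
    and row_nz: "row W j \<noteq> 0\<^sub>v c"
    and col_nz: "col W k \<noteq> 0\<^sub>v b"
    and p: "p < b"
    and A: "A \<in> carrier_mat a b"
    and A_jp: "A $$ (j, p) = (l2_norm (col C j) rpow \<alpha>) * inverse (l1_norm (row W j))"
    and A_0: "\<And>u v. u < a \<Longrightarrow> v < b \<Longrightarrow> (u, v) \<noteq> (j, p) \<Longrightarrow> A $$ (u, v) = 0"
    and s: "s < c"
    and B: "B \<in> carrier_mat c d"
    and B_sk: "B $$ (s, k) = (l2_norm (col C j) rpow \<alpha>) * inverse (l1_norm (col W k))"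
    and B_0: "\<And>u v. u < c \<Longrightarrow> v < d \<Longrightarrow> (u, v) \<noteq> (s, k) \<Longrightarrow> B $$ (u, v) = 0"
  shows "l2_norm (row A j) + l2_norm (col B k) =
           (inverse (l1_norm (row W j)) + inverse (l1_norm (col W k))) * (l2_norm (col C j) rpow \<alpha>)
         \<and> (\<forall>X \<in> carrier_mat a b. col C j = col X j \<longrightarrow>
             \<bar>W $$ (j, k)\<bar> * (l2_norm (row A j) + l2_norm (col B k)) = RIA \<alpha> X W j k)"
proof -
  let ?n = "l2_norm (col C j) rpow \<alpha>"
  have "l2_norm (row A j) = \<bar>row A j $ p\<bar>"
    using A j p A_0 by (intro l2_norm_single_entry) auto
  \<comment> \<open>Nonnegativity of \<open>?n\<close> and of the l1 norm removes the absolute value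
    around the entry given by \<open>A_jp\<close>.\<close>
  then have row_norm: "l2_norm (row A j) = ?n * inverse (l1_norm (row W j))"
    using A j p by (simp add: A_jp abs_mult rpow_nonneg l1_norm_nonneg)
  have "l2_norm (col B k) = \<bar>col B k $ s\<bar>"
    using B k s B_0 by (intro l2_norm_single_entry) auto
  then have col_norm: "l2_norm (col B k) = ?n * inverse (l1_norm (col W k))"
    using B k s by (simp add: B_sk abs_mult rpow_nonneg l1_norm_nonneg)
  show ?thesis
    \<comment> \<open>Only distributivity remains; for the RIA claim, the equation
      \<open>col C j = col X j\<close> turns \<open>?n\<close> into the activation factor of
      \<open>X\<close>.\<close>
    unfolding row_norm col_norm RIA_def by (auto simp: distrib_left distrib_right)
qed

end
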